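(* Let $P=\{1,\dots,n\}$, let $\mathcal H^{(a)}$ ($a\in P$) be complex Hilbert spaces of finite dimension $d_a$, and let $\rho$ be a density operator on $\mathcal H^{(1)}\otimes\cdots\otimes\mathcal H^{(n)}$. If there exists a subset $S\subseteq P$ such that the $S$-correlation strength satisfies $$L_S(\rho)>L_S^{\mathrm{pure}}=\prod_{a\in S}(d_a-1),$$ then $\rho$ is entangled.
   Context: For each party $a\in P$ fix hermitian operators $\sigma^{(a)}_0=\mathbf 1,\sigma^{(a)}_1,\dots,\sigma^{(a)}_{d_a^2-1}$ on $\mathcal H^{(a)}$ with $\operatorname{tr}(\sigma^{(a)}_i\sigma^{(a)}_j)=d_a\,\delta_{ij}$; in particular $\sigma_i^{(a)}$ is traceless for $i\ge 1$, and these operators form a real orthogonal basis of the hermitian operators on $\mathcal H^{(a)}$. The product operators $\sigma^{(1)}_{i_1}\otimes\cdots\otimes\sigma^{(n)}_{i_n}$ with $0\le i_a\le d_a^2-1$ form a basis $\mathcal B$ of the real vector space of hermitian operators on $\mathcal H^{(1)}\otimes\cdots\otimes\mathcal H^{(n)}$. For $S\subseteq P$, the set $\mathcal B_S$ of $S$-correlation operators consists of those elements of $\mathcal B$ for which $\{a\in P: i_a\neq 0\}=S$. The $S$-correlation strength of $\rho$ is $L_S(\rho)=\sum_{\sigma\in\mathcal B_S}\bigl(\operatorname{tr}(\rho\,\sigma)\bigr)^2$. The number $L_S^{\mathrm{pure}}=\prod_{a\in S}(d_a-1)$ is the common value of $L_S$ on all pure product states $|\psi_1\rangle\langle\psi_1|\otimes\cdots\otimes|\psi_n\rangle\langle\psi_n|$.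 A state $\rho$ is separable if it is a convex combination of pure product states $|\psi_1\rangle\langle\psi_1|\otimes\cdots\otimes|\psi_n\rangle\langle\psi_n|$ with unit vectors $\psi_a\in\mathcal H^{(a)}$; it is entangled if it is not separable. *)

theory Defs
  imports "Jordan_Normal_Form.Schur_Decomposition"
begin

text \<open>
  A Hilbert space of dimension \<open>d\<close> is rendered, in an orthonormal basis, as \<open>carrier_vec d\<close>
  over the complex numbers, with inner product \<open>v \<bullet>c w\<close> (conjugate linear in \<open>w\<close>).
  Operators are complex matrices. The parties are \<open>{1..n}\<close>, party \<open>a\<close> has dimension \<open>d a\<close>, and
  the tensor product space has dimension \<open>\<Prod>a\<in>{1..n}. d a\<close>.
\<close>

definition mat_trace :: "complex mat \<Rightarrow> complex" where
  "mat_trace A = (\<Sum>i<dim_row A. A $$ (i, i))"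

definition hermitian :: "complex mat \<Rightarrow> bool" where
  "hermitian A \<longleftrightarrow> mat_adjoint A = A"

definition kron :: "complex mat \<Rightarrow> complex mat \<Rightarrow> complex mat" where
  "kron A B = mat (dim_row A * dim_row B) (dim_col A * dim_col B)
     (\<lambda>(i, j). A $$ (i div dim_row B, j div dim_col B) * B $$ (i mod dim_row B, j mod dim_col B))"

text \<open>\<open>tensor n A\<close> is the product of \<open>A 1\<close> up to \<open>A n\<close>, in this order.\<close>

primrec tensor :: "nat \<Rightarrow> (nat \<Rightarrow> complex mat) \<Rightarrow> complex mat" where
  "tensor 0 A = 1\<^sub>m 1"
| "tensor (Suc n) A = kron (tensor n A) (A (Suc n))"

definition ketbra :: "complex vec \<Rightarrow> complex mat" where
  "ketbra \<psi> = mat (dim_vec \<psi>) (dim_vec \<psi>) (\<lambda>(i, j). \<psi> $ i * cnj (\<psi> $ j))"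

definition unit_vector :: "nat \<Rightarrow> complex vec \<Rightarrow> bool" where
  "unit_vector d \<psi> \<longleftrightarrow> \<psi> \<in> carrier_vec d \<and> \<psi> \<bullet>c \<psi> = 1"

text \<open>
  In the order on complex numbers used here, \<open>0 \<le> z\<close> says that \<open>z\<close> is real and nonnegative, so
  that the positivity condition includes hermiticity.
\<close>

definition density_operator :: "nat \<Rightarrow> complex mat \<Rightarrow> bool" where
  "density_operator N \<rho> \<longleftrightarrow> \<rho> \<in> carrier_mat N N
     \<and> (\<forall>v\<in>carrier_vec N. 0 \<le> (\<rho> *\<^sub>v v) \<bullet>c v) \<and> mat_trace \<rho> = 1"

definition local_basis :: "nat \<Rightarrow> (nat \<Rightarrow> complex mat) \<Rightarrow> bool" where
  "local_basis d \<tau> \<longleftrightarrow> \<tau> 0 = 1\<^sub>m d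
     \<and> (\<forall>i<d\<^sup>2. \<tau> i \<in> carrier_mat d d \<and> hermitian (\<tau> i))
     \<and> (\<forall>i<d\<^sup>2. \<forall>j<d\<^sup>2. mat_trace (\<tau> i * \<tau> j) = (if i = j then of_nat d else 0))"

definition correlation_operators ::
  "nat \<Rightarrow> (nat \<Rightarrow> nat) \<Rightarrow> (nat \<Rightarrow> nat \<Rightarrow> complex mat) \<Rightarrow> nat set \<Rightarrow> complex mat set" where
  "correlation_operators n d \<sigma> S =
     {tensor n (\<lambda>a. \<sigma> a (i a)) | i.
        (\<forall>a\<in>{1..n}. i a < (d a)\<^sup>2) \<and> {a\<in>{1..n}. i a \<noteq> 0} = S}"

text \<open>
  For hermitian \<open>\<rho>\<close> the traces below are real; \<open>Re\<close> only changes the type.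
\<close>

definition correlation_strength ::
  "nat \<Rightarrow> (nat \<Rightarrow> nat) \<Rightarrow> (nat \<Rightarrow> nat \<Rightarrow> complex mat) \<Rightarrow> nat set \<Rightarrow> complex mat \<Rightarrow> real" where
  "correlation_strength n d \<sigma> S \<rho> =
     (\<Sum>B\<in>correlation_operators n d \<sigma> S. (Re (mat_trace (\<rho> * B)))\<^sup>2)"

text \<open>
  The convex combination is written entrywise because \<open>complex mat\<close> contains matrices of all
  sizes and hence is not an instance of the class \<open>comm_monoid_add\<close>.
\<close>

definition separable :: "nat \<Rightarrow> (nat \<Rightarrow> nat) \<Rightarrow> complex mat \<Rightarrow> bool" where
  "separable n d \<rho> \<longleftrightarrow>
     (\<exists>(k::nat) (p :: nat \<Rightarrow> real) (\<psi> :: nat \<Rightarrow> nat \<Rightarrow> complex vec).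
        (\<forall>j<k. 0 \<le> p j) \<and> (\<Sum>j<k. p j) = 1
        \<and> (\<forall>j<k. \<forall>a\<in>{1..n}. unit_vector (d a) (\<psi> j a))
        \<and> \<rho> = mat (\<Prod>a\<in>{1..n}. d a) (\<Prod>a\<in>{1..n}. d a)
             (\<lambda>rc. \<Sum>j<k. complex_of_real (p j) * tensor n (\<lambda>a. ketbra (\<psi> j a)) $$ rc))"

definition entangled :: "nat \<Rightarrow> (nat \<Rightarrow> nat) \<Rightarrow> complex mat \<Rightarrow> bool" where
  "entangled n d \<rho> \<longleftrightarrow> \<not> separable n d \<rho>"

end

theory Submission
  imports Defs
begin

text \<open>
  Every party contributes to \<open>L\<^sub>S\<close> of a pure product state a factor: \<open>(tr K)\<^sup>2 = 1\<close> outside \<open>S\<close>, and at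
  most \<open>d - 1\<close> inside \<open>S\<close> by Bessel's inequality for the Hilbert-Schmidt inner product, applied to the
  projector \<open>K\<close> and the orthogonal family \<open>\<tau> 0, \<tau> 1, \<dots>\<close>, where the term of \<open>\<tau> 0 = 1\<close> is split off. Since the
  trace is multiplicative over tensor products, \<open>L\<^sub>S\<close> is at most \<open>\<Prod>a\<in>S. d a - 1\<close> on pure product
  states, and by convexity of the square this bound extends to separable states.
\<close>

section \<open>Bessel's inequality and convexity of the square\<close>

text \<open>Since each \<open>f i\<close> has squared norm \<open>D\<close>, the orthogonal
  projection of \<open>K\<close> onto their span is \<open>M / D\<close> with \<open>M\<close> the
  sum of the \<open>c i * f i\<close>. Expanding the squared norm of \<open>D * K - M\<close>, a
  rescaled residual that avoids division, yields \<open>D * (D * k - s)\<close>, and this is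
  nonnegative.\<close>

lemma bessel_finite_sum:
  fixes f :: "'i \<Rightarrow> 'x \<Rightarrow> complex" and D :: real
  assumes "finite I" and "D > 0"
    and orth: "\<And>i j. i \<in> I \<Longrightarrow> j \<in> I \<Longrightarrow>
      (\<Sum>x\<in>X. f i x * cnj (f j x)) = (if i = j then of_real D else 0)"
  shows "(\<Sum>i\<in>I. (cmod (\<Sum>x\<in>X. K x * cnj (f i x)))\<^sup>2) \<le> D * (\<Sum>x\<in>X. (cmod (K x))\<^sup>2)"
proof -
  define c where "c i = (\<Sum>x\<in>X. K x * cnj (f i x))" for i
  define M where "M x = (\<Sum>i\<in>I. c i * f i x)" for x
  define s where "s = (\<Sum>i\<in>I. (cmod (c i))\<^sup>2)"
  define k where "k = (\<Sum>x\<in>X. (cmod (K x))\<^sup>2)"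
  have ccnj: "cnj (c i) = (\<Sum>x\<in>X. cnj (K x) * f i x)" for i
    by (simp add: c_def)
  have KM: "(\<Sum>x\<in>X. K x * cnj (M x)) = of_real s"
  proof -
    have "(\<Sum>x\<in>X. K x * cnj (M x)) = (\<Sum>x\<in>X. \<Sum>i\<in>I. cnj (c i) * (K x * cnj (f i x)))"
      by (simp add: M_def sum_distrib_left mult_ac)
    also have "\<dots> = (\<Sum>i\<in>I. cnj (c i) * c i)"
      by (subst sum.swap) (simp add: c_def sum_distrib_left)
    also have "\<dots> = of_real s"
      by (simp add: s_def complex_norm_square mult.commute del: of_real_power)
    finally show ?thesis .
  qed
  have MK: "(\<Sum>x\<in>X. M x * cnj (K x)) = of_real s"
    using arg_cong[OF KM, of cnj] by (simp add: mult.commute)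
  have MM: "(\<Sum>x\<in>X. M x * cnj (M x)) = of_real (D * s)"
  proof -
    have "(\<Sum>x\<in>X. M x * cnj (M x))
        = (\<Sum>x\<in>X. \<Sum>i\<in>I. \<Sum>j\<in>I. c i * cnj (c j) * (f i x * cnj (f j x)))"
      by (simp add: M_def sum_product mult_ac)
    also have "\<dots> = (\<Sum>i\<in>I. \<Sum>x\<in>X. \<Sum>j\<in>I. c i * cnj (c j) * (f i x * cnj (f j x)))"
      by (rule sum.swap)
    also have "\<dots> = (\<Sum>i\<in>I. \<Sum>j\<in>I. \<Sum>x\<in>X. c i * cnj (c j) * (f i x * cnj (f j x)))"
      by (intro sum.cong refl sum.swap)
    also have "\<dots> = (\<Sum>i\<in>I. \<Sum>j\<in>I. c i * cnj (c j) * (if i = j then of_real D else 0))"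
      by (intro sum.cong refl) (simp only: sum_distrib_left[symmetric] orth)
    also have "\<dots> = (\<Sum>i\<in>I. of_real D * (c i * cnj (c i)))"
      using \<open>finite I\<close> by (simp add: if_distrib mult_ac cong: if_cong)
    also have "\<dots> = of_real (D * s)"
      by (simp add: s_def complex_norm_square sum_distrib_left del: of_real_power)
    finally show ?thesis .
  qed
  have KK: "(\<Sum>x\<in>X. K x * cnj (K x)) = of_real k"
    by (simp add: k_def complex_norm_square del: of_real_power)
  have "of_real (\<Sum>x\<in>X. (cmod (of_real D * K x - M x))\<^sup>2)
      = (\<Sum>x\<in>X. (of_real D * K x - M x) * cnj (of_real D * K x - M x))"
    by (simp add: complex_norm_square del: of_real_power)
  also have "\<dots> = of_real D * of_real D * (\<Sum>x\<in>X. K x * cnj (K x)) - of_real D * (\<Sum>x\<in>X. K x * cnj (M x))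
      - of_real D * (\<Sum>x\<in>X. M x * cnj (K x)) + (\<Sum>x\<in>X. M x * cnj (M x))"
    by (simp add: sum_distrib_left algebra_simps sum.distrib sum_subtractf)
  also have "\<dots> = of_real (D * (D * k - s))"
    unfolding KK KM MK MM by (simp add: algebra_simps)
  finally have "(\<Sum>x\<in>X. (cmod (of_real D * K x - M x))\<^sup>2) = D * (D * k - s)"
    by (simp only: of_real_eq_iff)
  moreover have "(\<Sum>x\<in>X. (cmod (of_real D * K x - M x))\<^sup>2) \<ge> 0"
    by (simp add: sum_nonneg)
  ultimately have "D * k - s \<ge> 0"
    using \<open>D > 0\<close> by (simp add: zero_le_mult_iff)
  then show ?thesis
    by (simp add: s_def k_def c_def)
qed

text \<open>The difference of the two sides is the variance of \<open>x\<close> under the weights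
  \<open>p\<close>, with mean \<open>m\<close>.\<close>

lemma square_convex_sum_le:
  fixes p x :: "'a \<Rightarrow> real"
  assumes "\<And>j. j \<in> J \<Longrightarrow> 0 \<le> p j" and "sum p J = 1"
  shows "(\<Sum>j\<in>J. p j * x j)\<^sup>2 \<le> (\<Sum>j\<in>J. p j * (x j)\<^sup>2)"
proof -
  define m where "m = (\<Sum>j\<in>J. p j * x j)"
  have "0 \<le> (\<Sum>j\<in>J. p j * (x j - m)\<^sup>2)"
    using assms(1) by (intro sum_nonneg) simp
  also have "\<dots> = (\<Sum>j\<in>J. p j * (x j)\<^sup>2) - 2 * m * (\<Sum>j\<in>J. p j * x j) + m\<^sup>2 * sum p J"
    by (simp add: sum_distrib_left sum_distrib_right power2_eq_square algebra_simps
        sum.distrib sum_subtractf)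
  finally show ?thesis
    by (simp add: assms(2) m_def power2_eq_square)
qed

section \<open>Traces of products of Kronecker and tensor products\<close>

lemma mat_trace_mult:
  assumes "A \<in> carrier_mat N N" and "B \<in> carrier_mat N N"
  shows "mat_trace (A * B) = (\<Sum>i<N. \<Sum>j<N. A $$ (i, j) * B $$ (j, i))"
  using assms by (auto simp: mat_trace_def scalar_prod_def atLeast0LessThan intro!: sum.cong)

text \<open>The range falls into \<open>m\<close> consecutive blocks of length \<open>k\<close>; on
  block \<open>a\<close> the quotient is constantly \<open>a\<close> and the remainder runs once
  through \<open>{..<k}\<close>. This turns the flat index of \<open>kron\<close> into a pair of
  indices.\<close>

lemma sum_div_mod:
  fixes g :: "nat \<Rightarrow> nat \<Rightarrow> 'a::comm_monoid_add"
  shows "(\<Sum>i<m * k. g (i div k) (i mod k)) = (\<Sum>a<m. \<Sum>b<k. g a b)"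
proof -
  have "(\<Sum>i<m * k. g (i div k) (i mod k)) = (\<Sum>a<m. \<Sum>i\<in>{a * k..<a * k + k}. g (i div k) (i mod k))"
    by (simp add: sum.nat_group)
  also have "\<dots> = (\<Sum>a<m. \<Sum>b<k. g a b)"
  proof (rule sum.cong[OF refl])
    fix a
    have "(\<Sum>i\<in>{a * k..<a * k + k}. g (i div k) (i mod k))
        = (\<Sum>b\<in>{0..<k}. g ((b + a * k) div k) ((b + a * k) mod k))"
      using sum.shift_bounds_nat_ivl[of "\<lambda>i. g (i div k) (i mod k)" 0 "a * k" k]
      by (simp add: add.commute)
    also have "\<dots> = (\<Sum>b<k. g a b)"
      by (intro sum.cong) auto
    finally show "(\<Sum>i\<in>{a * k..<a * k + k}. g (i div k) (i mod k)) = (\<Sum>b<k. g a b)" .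
  qed
  finally show ?thesis .
qed

lemma kron_carrier:
  assumes "A \<in> carrier_mat m m" and "B \<in> carrier_mat k k"
  shows "kron A B \<in> carrier_mat (m * k) (m * k)"
  using assms by (simp add: kron_def)

text \<open>With row and column indices both split into pairs, every summand is a term in
  \<open>(a, a')\<close> times a term in \<open>(b, b')\<close>, so the fourfold sum
  factors.\<close>

lemma mat_trace_kron_mult:
  assumes A: "A \<in> carrier_mat m m" and B: "B \<in> carrier_mat k k"
    and C: "C \<in> carrier_mat m m" and D: "D \<in> carrier_mat k k"
  shows "mat_trace (kron A B * kron C D) = mat_trace (A * C) * mat_trace (B * D)"
proof -
  have "mat_trace (kron A B * kron C D)
      = (\<Sum>i<m * k. \<Sum>j<m * k. kron A B $$ (i, j) * kron C D $$ (j, i))"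
    by (rule mat_trace_mult) (use assms in \<open>auto intro: kron_carrier\<close>)
  also have "\<dots> = (\<Sum>i<m * k. \<Sum>j<m * k.
      A $$ (i div k, j div k) * B $$ (i mod k, j mod k) *
      (C $$ (j div k, i div k) * D $$ (j mod k, i mod k)))"
    using assms by (auto simp: kron_def intro!: sum.cong)
  also have "\<dots> = (\<Sum>a<m. \<Sum>b<k. \<Sum>a'<m. \<Sum>b'<k.
      A $$ (a, a') * B $$ (b, b') * (C $$ (a', a) * D $$ (b', b)))"
    \<comment> \<open>The first substitution splits the row index. The second splits the column
      index under the new sums; its blanks stand for the outer bound variables.\<close>
    by (subst sum_div_mod[of "\<lambda>a b. \<Sum>j<m * k. A $$ (a, j div k) * B $$ (b, j mod k) *
          (C $$ (j div k, a) * D $$ (j mod k, b))"],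
        subst sum_div_mod[where g = "\<lambda>a' b'. A $$ (_, a') * B $$ (_, b') *
          (C $$ (a', _) * D $$ (b', _))"]) (rule refl)
  also have "\<dots> = (\<Sum>a<m. \<Sum>b<k. (\<Sum>a'<m. A $$ (a, a') * C $$ (a', a)) *
      (\<Sum>b'<k. B $$ (b, b') * D $$ (b', b)))"
    by (simp add: sum_product mult_ac)
  also have "\<dots> = mat_trace (A * C) * mat_trace (B * D)"
    by (simp add: sum_product mat_trace_mult[OF A C] mat_trace_mult[OF B D])
  finally show ?thesis .
qed

lemma tensor_carrier:
  assumes "\<And>a. a \<in> {1..n} \<Longrightarrow> A a \<in> carrier_mat (d a) (d a)"
  shows "tensor n A \<in> carrier_mat (\<Prod>a\<in>{1..n}. d a) (\<Prod>a\<in>{1..n}. d a)"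
  using assms
proof (induction n)
  case (Suc n)
  then have "tensor n A \<in> carrier_mat (\<Prod>a\<in>{1..n}. d a) (\<Prod>a\<in>{1..n}. d a)"
    and "A (Suc n) \<in> carrier_mat (d (Suc n)) (d (Suc n))"
    by auto
  then show ?case
    by (simp add: kron_carrier)
qed simp

lemma tensor_cong:
  assumes "\<And>a. a \<in> {1..n} \<Longrightarrow> A a = B a"
  shows "tensor n A = tensor n B"
  using assms by (induction n) auto

lemma mat_trace_tensor_mult:
  assumes "\<And>a. a \<in> {1..n} \<Longrightarrow> A a \<in> carrier_mat (d a) (d a)"
    and "\<And>a. a \<in> {1..n} \<Longrightarrow> B a \<in> carrier_mat (d a) (d a)"
  shows "mat_trace (tensor n A * tensor n B) = (\<Prod>a\<in>{1..n}. mat_trace (A a * B a))"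
  using assms
proof (induction n)
  case 0
  then show ?case by (simp add: mat_trace_def)
next
  case (Suc n)
  have "mat_trace (tensor (Suc n) A * tensor (Suc n) B)
      = mat_trace (tensor n A * tensor n B) * mat_trace (A (Suc n) * B (Suc n))"
    unfolding tensor.simps
    by (rule mat_trace_kron_mult[where m = "\<Prod>a\<in>{1..n}. d a" and k = "d (Suc n)"])
      (use Suc.prems in \<open>auto intro!: tensor_carrier simp del: One_nat_def\<close>)
  also have "mat_trace (tensor n A * tensor n B) = (\<Prod>a\<in>{1..n}. mat_trace (A a * B a))"
    using Suc by auto
  finally show ?case by simp
qed

section \<open>The correlation bound for a single party\<close>

lemma hermitian_index:
  assumes "hermitian A" and "A \<in> carrier_mat N N" and "i < N" and "j < N"
  shows "cnj (A $$ (i, j)) = A $$ (j, i)"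
proof -
  have "A $$ (j, i) = mat_adjoint A $$ (j, i)"
    using assms(1) by (simp add: hermitian_def)
  also have "\<dots> = cnj (A $$ (i, j))"
    using assms(2-4) by (simp add: mat_adjoint_def mat_of_rows_def)
  finally show ?thesis by simp
qed

lemma ketbra_carrier:
  assumes "unit_vector d \<psi>"
  shows "ketbra \<psi> \<in> carrier_mat d d"
  using assms by (auto simp: ketbra_def unit_vector_def)

lemma unit_vector_sum:
  assumes "unit_vector d \<psi>"
  shows "(\<Sum>i<d. \<psi> $ i * cnj (\<psi> $ i)) = 1"
  using assms by (auto simp: unit_vector_def scalar_prod_def atLeast0LessThan)

lemma mat_trace_ketbra:
  assumes "unit_vector d \<psi>"
  shows "mat_trace (ketbra \<psi>) = 1"
  using unit_vector_sum[OF assms] assms by (auto simp: mat_trace_def ketbra_def unit_vector_def)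

text \<open>The squared moduli of the entries are products of a row term and a column term, so the
  sum is the square of the squared norm of \<open>\<psi>\<close>. It supplies the right-hand side of
  Bessel's inequality.\<close>

lemma ketbra_frobenius:
  assumes "unit_vector d \<psi>"
  shows "(\<Sum>(r, c)\<in>{..<d} \<times> {..<d}. (cmod (ketbra \<psi> $$ (r, c)))\<^sup>2) = 1"
proof -
  have 1: "(\<Sum>i<d. (cmod (\<psi> $ i))\<^sup>2) = 1"
  proof -
    have "complex_of_real (\<Sum>i<d. (cmod (\<psi> $ i))\<^sup>2) = 1"
      using unit_vector_sum[OF assms] by (simp add: complex_norm_square del: of_real_power)
    then show ?thesis by (simp only: of_real_eq_1_iff)
  qed
  have "(\<Sum>(r, c)\<in>{..<d} \<times> {..<d}. (cmod (ketbra \<psi> $$ (r, c)))\<^sup>2)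
      = (\<Sum>r<d. \<Sum>c<d. (cmod (\<psi> $ r))\<^sup>2 * (cmod (\<psi> $ c))\<^sup>2)"
    using assms
    by (auto simp: sum.cartesian_product ketbra_def unit_vector_def norm_mult power_mult_distrib
        intro!: sum.cong)
  also have "\<dots> = 1"
    using 1 by (simp flip: sum_product)
  finally show ?thesis .
qed

text \<open>Bessel's inequality over all indices below \<open>d\<^sup>2\<close> gives the bound
  \<open>d\<close>; the identity operator \<open>\<tau> 0\<close> alone accounts for 1 of
  it.\<close>

lemma local_correlations_le:
  assumes basis: "local_basis d \<tau>" and \<psi>: "unit_vector d \<psi>"
  shows "(\<Sum>i\<in>{1..<d\<^sup>2}. (cmod (mat_trace (ketbra \<psi> * \<tau> i)))\<^sup>2) \<le> real d - 1"
proof -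
  \<comment> \<open>There is no unit vector in dimension 0. Positivity of \<open>d\<close> is used
    both as the scale in Bessel's inequality and to have index 0 in the range.\<close>
  have "d \<noteq> 0"
    using unit_vector_sum[OF \<psi>] by (cases d) auto
  have car: "\<tau> i \<in> carrier_mat d d" and herm: "hermitian (\<tau> i)" if "i < d\<^sup>2" for i
    using basis that by (auto simp: local_basis_def)
  \<comment> \<open>Hermiticity exchanges conjugation for transposition, so the entrywise
    Hilbert-Schmidt product with \<open>\<tau> i\<close> is a plain trace.\<close>
  have inner: "(\<Sum>(r, c)\<in>{..<d} \<times> {..<d}. A $$ (r, c) * cnj (\<tau> i $$ (r, c))) = mat_trace (A * \<tau> i)"
    if "A \<in> carrier_mat d d" and "i < d\<^sup>2" for A i
    unfolding mat_trace_mult[OF that(1) car[OF that(2)]] sum.cartesian_product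
    by (intro sum.cong refl) (auto simp: hermitian_index[OF herm car] that)
  have "(\<Sum>i<d\<^sup>2. (cmod (\<Sum>x\<in>{..<d} \<times> {..<d}. ketbra \<psi> $$ x * cnj (\<tau> i $$ x)))\<^sup>2)
      \<le> real d * (\<Sum>x\<in>{..<d} \<times> {..<d}. (cmod (ketbra \<psi> $$ x))\<^sup>2)"
  proof (rule bessel_finite_sum)
    fix i j assume "i \<in> {..<d\<^sup>2}" "j \<in> {..<d\<^sup>2}"
    then show "(\<Sum>x\<in>{..<d} \<times> {..<d}. \<tau> i $$ x * cnj (\<tau> j $$ x))
        = (if i = j then of_real (real d) else 0)"
      using inner[OF car, of i j] basis by (simp add: local_basis_def case_prod_unfold)
  qed (use \<open>d \<noteq> 0\<close> in auto)
  then have "(\<Sum>i<d\<^sup>2. (cmod (mat_trace (ketbra \<psi> * \<tau> i)))\<^sup>2) \<le> real d"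
    using ketbra_frobenius[OF \<psi>] inner[OF ketbra_carrier[OF \<psi>]] by (simp add: case_prod_unfold)
  moreover have "{..<d\<^sup>2} = insert 0 {1..<d\<^sup>2}"
    using \<open>d \<noteq> 0\<close> by auto
  moreover have "mat_trace (ketbra \<psi> * \<tau> 0) = 1"
    using basis ketbra_carrier[OF \<psi>] mat_trace_ketbra[OF \<psi>] by (simp add: local_basis_def)
  ultimately show ?thesis
    by simp
qed

section \<open>Indexing the correlation operators\<close>

text \<open>Extensional functions make the index set finite, and its product form lets a sum over it
  of products over the parties factor into local sums.\<close>

definition correlation_index :: "nat \<Rightarrow> (nat \<Rightarrow> nat) \<Rightarrow> nat set \<Rightarrow> (nat \<Rightarrow> nat) set" where
  "correlation_index n d S = PiE {1..n} (\<lambda>a. if a \<in> S then {1..<(d a)\<^sup>2} else {0})"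

lemma finite_correlation_index: "finite (correlation_index n d S)"
  unfolding correlation_index_def by (intro finite_PiE) auto

text \<open>The condition \<open>d a \<noteq> 0\<close> serves parties outside \<open>S\<close>:
  their index is 0, which must lie below \<open>(d a)\<^sup>2\<close>.\<close>

lemma correlation_index_less:
  assumes "i \<in> correlation_index n d S" and "a \<in> {1..n}" and "d a \<noteq> 0"
  shows "i a < (d a)\<^sup>2"
  using assms by (auto simp: correlation_index_def PiE_iff split: if_splits dest!: bspec[of _ _ a])

text \<open>Index functions in \<open>correlation_operators\<close> are arbitrary outside
  \<open>{1..n}\<close>; restricting them there leaves the operator unchanged, as
  \<open>tensor n\<close> reads only the factors in \<open>{1..n}\<close>.\<close>

lemma correlation_operators_subset:
  "correlation_operators n d \<sigma> S
    \<subseteq> (\<lambda>i. tensor n (\<lambda>a. \<sigma> a (i a))) ` correlation_index n d S"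
proof
  fix B assume "B \<in> correlation_operators n d \<sigma> S"
  then obtain i where B: "B = tensor n (\<lambda>a. \<sigma> a (i a))"
    and i: "\<forall>a\<in>{1..n}. i a < (d a)\<^sup>2" "{a\<in>{1..n}. i a \<noteq> 0} = S"
    unfolding correlation_operators_def by blast
  have "restrict i {1..n} \<in> correlation_index n d S"
    using i by (auto simp: correlation_index_def)
  moreover have "B = tensor n (\<lambda>a. \<sigma> a (restrict i {1..n} a))"
    unfolding B by (rule tensor_cong) simp
  ultimately show "B \<in> (\<lambda>i. tensor n (\<lambda>a. \<sigma> a (i a))) ` correlation_index n d S"
    by blast
qed

text \<open>An operator reached from several indices counts once on the left and repeatedly on the
  right; squares are nonnegative, so the sum can only grow.\<close>

lemma correlation_strength_le:
  "correlation_strength n d \<sigma> S \<rho>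
    \<le> (\<Sum>i\<in>correlation_index n d S. (Re (mat_trace (\<rho> * tensor n (\<lambda>a. \<sigma> a (i a)))))\<^sup>2)"
proof -
  have "correlation_strength n d \<sigma> S \<rho>
      \<le> (\<Sum>B\<in>(\<lambda>i. tensor n (\<lambda>a. \<sigma> a (i a))) ` correlation_index n d S. (Re (mat_trace (\<rho> * B)))\<^sup>2)"
    unfolding correlation_strength_def
    by (rule sum_mono2) (auto intro: finite_correlation_index subsetD[OF correlation_operators_subset])
  also have "\<dots> \<le> (\<Sum>i\<in>correlation_index n d S. (Re (mat_trace (\<rho> * tensor n (\<lambda>a. \<sigma> a (i a)))))\<^sup>2)"
    using sum_image_le[OF finite_correlation_index,
        of n d S "\<lambda>B. (Re (mat_trace (\<rho> * B)))\<^sup>2" "\<lambda>i. tensor n (\<lambda>a. \<sigma> a (i a))"]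
    by (simp add: o_def)
  finally show ?thesis .
qed

section \<open>Bounds for pure product states and for separable states\<close>

lemma pure_product_correlations_le:
  assumes basis: "\<And>a. a \<in> {1..n} \<Longrightarrow> local_basis (d a) (\<sigma> a)"
    and \<psi>: "\<And>a. a \<in> {1..n} \<Longrightarrow> unit_vector (d a) (\<psi> a)"
    and S: "S \<subseteq> {1..n}"
  shows "(\<Sum>i\<in>correlation_index n d S.
      (Re (mat_trace (tensor n (\<lambda>a. ketbra (\<psi> a)) * tensor n (\<lambda>a. \<sigma> a (i a)))))\<^sup>2)
    \<le> (\<Prod>a\<in>S. real (d a) - 1)" (is "?L \<le> _")
proof -
  let ?t = "\<lambda>a k. (cmod (mat_trace (ketbra (\<psi> a) * \<sigma> a k)))\<^sup>2"
  have d: "d a \<noteq> 0" if "a \<in> {1..n}" for a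
    using unit_vector_sum[OF \<psi>[OF that]] by (cases "d a") auto
  have "?L \<le> (\<Sum>i\<in>correlation_index n d S. \<Prod>a\<in>{1..n}. ?t a (i a))"
  proof (rule sum_mono)
    fix i assume i: "i \<in> correlation_index n d S"
    have "mat_trace (tensor n (\<lambda>a. ketbra (\<psi> a)) * tensor n (\<lambda>a. \<sigma> a (i a)))
        = (\<Prod>a\<in>{1..n}. mat_trace (ketbra (\<psi> a) * \<sigma> a (i a)))" (is "?z = _")
      by (rule mat_trace_tensor_mult[where d = d])
        (use \<psi> ketbra_carrier basis correlation_index_less[OF i] d in \<open>auto simp: local_basis_def\<close>)
    \<comment> \<open>Replacing the real part by the modulus makes the estimate multiplicative over
      the parties.\<close>
    then have "(cmod ?z)\<^sup>2 = (\<Prod>a\<in>{1..n}. ?t a (i a))"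
      by (simp add: prod_power_distrib flip: prod_norm)
    moreover have "(Re ?z)\<^sup>2 \<le> (cmod ?z)\<^sup>2"
      using abs_Re_le_cmod by (metis abs_ge_zero power2_abs power_mono)
    ultimately show "(Re ?z)\<^sup>2 \<le> (\<Prod>a\<in>{1..n}. ?t a (i a))"
      by simp
  qed
  \<comment> \<open>Distributivity: the sum over all index functions becomes a product of
    independent local sums, one per party.\<close>
  also have "\<dots> = (\<Prod>a\<in>{1..n}. \<Sum>k\<in>(if a \<in> S then {1..<(d a)\<^sup>2} else {0}). ?t a k)"
    unfolding correlation_index_def by (rule prod_sum_PiE[symmetric]) auto
  also have "\<dots> \<le> (\<Prod>a\<in>{1..n}. if a \<in> S then real (d a) - 1 else 1)"
  proof (rule prod_mono)
    fix a assume a: "a \<in> {1..n}"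
    have "mat_trace (ketbra (\<psi> a) * \<sigma> a 0) = 1"
      using basis[OF a] ketbra_carrier[OF \<psi>[OF a]] mat_trace_ketbra[OF \<psi>[OF a]]
      by (simp add: local_basis_def)
    then show "0 \<le> (\<Sum>k\<in>(if a \<in> S then {1..<(d a)\<^sup>2} else {0}). ?t a k) \<and>
        (\<Sum>k\<in>(if a \<in> S then {1..<(d a)\<^sup>2} else {0}). ?t a k) \<le> (if a \<in> S then real (d a) - 1 else 1)"
      using local_correlations_le[OF basis[OF a] \<psi>[OF a]] by (auto intro: sum_nonneg)
  qed
  also have "\<dots> = (\<Prod>a\<in>S. real (d a) - 1)"
    using S by (simp add: prod.inter_restrict[symmetric] Int_absorb1)
  finally show ?thesis .
qed

lemma mat_trace_convex_mult:
  assumes "\<And>j. j < k \<Longrightarrow> T j \<in> carrier_mat N N" and "B \<in> carrier_mat N N"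
  shows "mat_trace (mat N N (\<lambda>rc. \<Sum>j<k. complex_of_real (p j) * T j $$ rc) * B)
    = (\<Sum>j<k. complex_of_real (p j) * mat_trace (T j * B))"
proof -
  have "mat_trace (mat N N (\<lambda>rc. \<Sum>j<k. complex_of_real (p j) * T j $$ rc) * B)
      = (\<Sum>r<N. \<Sum>c<N. \<Sum>j<k. complex_of_real (p j) * (T j $$ (r, c) * B $$ (c, r)))"
    using assms(2) by (subst mat_trace_mult) (auto simp: sum_distrib_right mult.assoc intro!: sum.cong)
  also have "\<dots> = (\<Sum>r<N. \<Sum>j<k. \<Sum>c<N. complex_of_real (p j) * (T j $$ (r, c) * B $$ (c, r)))"
    by (intro sum.cong refl sum.swap)
  also have "\<dots> = (\<Sum>j<k. \<Sum>r<N. \<Sum>c<N. complex_of_real (p j) * (T j $$ (r, c) * B $$ (c, r)))"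
    by (rule sum.swap)
  also have "\<dots> = (\<Sum>j<k. complex_of_real (p j) * mat_trace (T j * B))"
    using assms by (intro sum.cong refl) (simp add: mat_trace_mult[of _ N] sum_distrib_left)
  finally show ?thesis .
qed

text \<open>Each trace against \<open>\<rho>\<close> is the \<open>p\<close>-average of the traces
  against the product states \<open>T j\<close>. Convexity moves the average outside the square, and
  the bound for pure product states is the same for every \<open>j\<close>.\<close>

lemma separable_correlation_strength_le:
  assumes basis: "\<And>a. a \<in> {1..n} \<Longrightarrow> local_basis (d a) (\<sigma> a)"
    and "separable n d \<rho>" and S: "S \<subseteq> {1..n}"
  shows "correlation_strength n d \<sigma> S \<rho> \<le> (\<Prod>a\<in>S. real (d a) - 1)"
proof -
  let ?N = "\<Prod>a\<in>{1..n}. d a"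
  let ?bound = "\<Prod>a\<in>S. real (d a) - 1"
  obtain k :: nat and p :: "nat \<Rightarrow> real" and \<psi> :: "nat \<Rightarrow> nat \<Rightarrow> complex vec" where
    p: "\<forall>j<k. 0 \<le> p j" "(\<Sum>j<k. p j) = 1"
    and \<psi>: "\<forall>j<k. \<forall>a\<in>{1..n}. unit_vector (d a) (\<psi> j a)"
    and \<rho>: "\<rho> = mat ?N ?N
      (\<lambda>rc. \<Sum>j<k. complex_of_real (p j) * tensor n (\<lambda>a. ketbra (\<psi> j a)) $$ rc)"
    using assms(2) unfolding separable_def by blast
  define T where "T j = tensor n (\<lambda>a. ketbra (\<psi> j a))" for j
  define B where "B i = tensor n (\<lambda>a. \<sigma> a (i a))" for i
  have T: "T j \<in> carrier_mat ?N ?N" if "j < k" for j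
    unfolding T_def using \<psi> that by (intro tensor_carrier ketbra_carrier) auto
  \<comment> \<open>The weights sum to 1, so some product state occurs; its unit vectors show that
    no \<open>d a\<close> vanishes.\<close>
  have "k \<noteq> 0"
    using p(2) by (metis lessThan_0 sum.empty zero_neq_one)
  have d: "d a \<noteq> 0" if "a \<in> {1..n}" for a
  proof -
    have "unit_vector (d a) (\<psi> 0 a)"
      using \<psi> \<open>k \<noteq> 0\<close> that by auto
    from unit_vector_sum[OF this] show ?thesis
      by (cases "d a") auto
  qed
  have "correlation_strength n d \<sigma> S \<rho> \<le> (\<Sum>i\<in>correlation_index n d S. (Re (mat_trace (\<rho> * B i)))\<^sup>2)"
    unfolding B_def by (rule correlation_strength_le)
  also have "\<dots> \<le> (\<Sum>i\<in>correlation_index n d S. \<Sum>j<k. p j * (Re (mat_trace (T j * B i)))\<^sup>2)"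
  proof (rule sum_mono)
    fix i assume i: "i \<in> correlation_index n d S"
    have "B i \<in> carrier_mat ?N ?N"
      unfolding B_def using basis correlation_index_less[OF i] d
      by (intro tensor_carrier) (auto simp: local_basis_def)
    then have "Re (mat_trace (\<rho> * B i)) = (\<Sum>j<k. p j * Re (mat_trace (T j * B i)))"
      unfolding \<rho> T_def[symmetric] using T by (simp add: mat_trace_convex_mult)
    then show "(Re (mat_trace (\<rho> * B i)))\<^sup>2 \<le> (\<Sum>j<k. p j * (Re (mat_trace (T j * B i)))\<^sup>2)"
      using square_convex_sum_le[of "{..<k}" p] p by simp
  qed
  \<comment> \<open>After the exchange of sums, each inner sum concerns one pure product
    state.\<close>
  also have "\<dots> = (\<Sum>j<k. p j * (\<Sum>i\<in>correlation_index n d S. (Re (mat_trace (T j * B i)))\<^sup>2))"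
    by (subst sum.swap) (simp add: sum_distrib_left)
  also have "\<dots> \<le> (\<Sum>j<k. p j * ?bound)"
    using p \<psi> unfolding T_def B_def
    by (intro sum_mono mult_left_mono pure_product_correlations_le basis S) auto
  also have "\<dots> = ?bound"
    using p(2) by (simp flip: sum_distrib_right)
  finally show ?thesis .
qed

theorem theorem2:
  fixes n :: nat and d :: "nat \<Rightarrow> nat" and \<sigma> :: "nat \<Rightarrow> nat \<Rightarrow> complex mat"
    and \<rho> :: "complex mat"
  assumes "\<And>a. a \<in> {1..n} \<Longrightarrow> local_basis (d a) (\<sigma> a)"
    and "density_operator (\<Prod>a\<in>{1..n}. d a) \<rho>"
    and "\<exists>S\<subseteq>{1..n}. correlation_strength n d \<sigma> S \<rho> > (\<Prod>a\<in>S. real (d a) - 1)"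
  shows "entangled n d \<rho>"
  \<comment> \<open>By contraposition: for separable \<open>\<rho>\<close> the bound holds for every
    \<open>S\<close>, contradicting the given one.\<close>
  using separable_correlation_strength_le[OF assms(1)] assms(3)
  by (force simp: entangled_def not_le[symmetric])

end
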